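(* Let $\lambda_1,\lambda_2\in\mathbb{R}$, let $A=\begin{pmatrix}\lambda_1&0\\0&\lambda_2\end{pmatrix}$, and let $T:\mathbb{R}^2\to\mathbb{R}^2$, $Tx=Ax$. (i) If $\lambda_1=\lambda_2$ and $|\lambda_1|\le1$, then $T$ is not weakly sensitive in weak topology. (ii) Otherwise, $T$ is weakly sensitive in weak topology.
   Context: Let $\mathbb{N}=\{1,2,3,\dots\}$. Continuous linear functionals on $\mathbb{R}^2$ are identified with vectors $x^*\in\mathbb{R}^2$ via $\langle x,x^*\rangle=x_1x_1^*+x_2x_2^*$, and $p_{x^*}(x)=|\langle x,x^*\rangle|$. $T$ is weakly sensitive in weak topology if there are $\delta>0$ and a nonzero $x^*$ such that for every $x_0\in\mathbb{R}^2$ and every $\varepsilon>0$ there exist $x,y\in\mathbb{R}^2$ and $n\in\mathbb{N}$ with $p_{x^*}(x-x_0)<\varepsilon$, $p_{x^*}(y-x_0)<\varepsilon$ and $p_{x^*}(T^nx-T^ny)>\delta$. *)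

theory Defs
  imports "HOL-Analysis.Analysis"
begin

definition weak_seminorm :: "real ^ 2 \<Rightarrow> real ^ 2 \<Rightarrow> real" where
  "weak_seminorm x' x = \<bar>x \<bullet> x'\<bar>"

text \<open>Continuous linear functionals on the plane are identified with vectors \<open>x'\<close>,
  and the iterates \<open>T ^^ n\<close> range over the positive integers \<open>n\<close>.\<close>

definition weakly_sensitive_weak_topology :: "(real ^ 2 \<Rightarrow> real ^ 2) \<Rightarrow> bool" where
  "weakly_sensitive_weak_topology T \<longleftrightarrow>
     (\<exists>\<delta>>0. \<exists>x'. x' \<noteq> 0 \<and>
        (\<forall>x0. \<forall>\<epsilon>>0. \<exists>x y. \<exists>n\<ge>1.
            weak_seminorm x' (x - x0) < \<epsilon> \<and>
            weak_seminorm x' (y - x0) < \<epsilon> \<and>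
            weak_seminorm x' ((T ^^ n) x - (T ^^ n) y) > \<delta>))"

end

theory Submission
  imports Defs
begin

text \<open>For a linear map sensitivity does not depend on the base point \<open>x0\<close>: it says that some
  nonzero functional \<open>x'\<close> is arbitrarily small on vectors \<open>z\<close> that have an iterate on which
  \<open>x'\<close> exceeds a fixed \<open>\<delta>\<close> in modulus (\<open>weakly_sensitive_linear_iff\<close>). The iterates of a
  scalar map multiply every functional by powers of the scalar, so this happens exactly when the scalar has modulus
  greater than \<open>1\<close>. If the eigenvalues differ, their sizes are irrelevant: the kernel of
  \<open>x' = (1, 1)\<close> is not invariant, so \<open>x'\<close> vanishes on some \<open>z\<close> without vanishing on
  \<open>T z\<close>.\<close>

lemma funpow_diff:
  fixes T :: "'a::real_vector \<Rightarrow> 'a"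
  assumes "linear T"
  shows "(T ^^ n) (x - y) = (T ^^ n) x - (T ^^ n) y"
  by (induction n) (simp_all add: linear_diff[OF assms])

text \<open>The difference of two points close to \<open>x0\<close> is small, and conversely a small vector is
  the difference of the nearby points \<open>x0 + z\<close> and \<open>x0\<close>; linearity of the iterates carries
  both differences along the orbit.\<close>

lemma weakly_sensitive_linear_iff:
  assumes "linear T"
  shows "weakly_sensitive_weak_topology T \<longleftrightarrow>
    (\<exists>\<delta>>0. \<exists>x'. x' \<noteq> 0 \<and> (\<forall>\<epsilon>>0. \<exists>z. \<exists>n\<ge>1.
      weak_seminorm x' z < \<epsilon> \<and> weak_seminorm x' ((T ^^ n) z) > \<delta>))"
    (is "_ \<longleftrightarrow> ?R")
proof
  assume "weakly_sensitive_weak_topology T"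
  then obtain \<delta> x' where "\<delta> > 0" "x' \<noteq> 0" and
    sens: "\<And>x0 \<epsilon>. \<epsilon> > 0 \<Longrightarrow> \<exists>x y. \<exists>n\<ge>1. weak_seminorm x' (x - x0) < \<epsilon> \<and>
      weak_seminorm x' (y - x0) < \<epsilon> \<and> weak_seminorm x' ((T ^^ n) x - (T ^^ n) y) > \<delta>"
    unfolding weakly_sensitive_weak_topology_def by blast
  have "\<exists>z. \<exists>n\<ge>1. weak_seminorm x' z < \<epsilon> \<and> weak_seminorm x' ((T ^^ n) z) > \<delta>"
    if \<epsilon>: "\<epsilon> > 0" for \<epsilon>
  proof -
    obtain x y n where n: "n \<ge> 1" and x: "weak_seminorm x' (x - 0) < \<epsilon> / 2"
      and y: "weak_seminorm x' (y - 0) < \<epsilon> / 2"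
      and big: "weak_seminorm x' ((T ^^ n) x - (T ^^ n) y) > \<delta>"
      using sens[of "\<epsilon> / 2" 0] \<epsilon> by auto
    have "weak_seminorm x' (x - y) < \<epsilon>"
      using x y by (simp add: weak_seminorm_def inner_diff_left)
    then show ?thesis
      using n big by (metis funpow_diff[OF assms])
  qed
  then show ?R
    using \<open>\<delta> > 0\<close> \<open>x' \<noteq> 0\<close> by blast
next
  assume ?R
  then obtain \<delta> x' where "\<delta> > 0" "x' \<noteq> 0" and
    amp: "\<And>\<epsilon>. \<epsilon> > 0 \<Longrightarrow> \<exists>z. \<exists>n\<ge>1.
      weak_seminorm x' z < \<epsilon> \<and> weak_seminorm x' ((T ^^ n) z) > \<delta>"
    by blast
  have "\<exists>x y. \<exists>n\<ge>1. weak_seminorm x' (x - x0) < \<epsilon> \<and> weak_seminorm x' (y - x0) < \<epsilon> \<and>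
      weak_seminorm x' ((T ^^ n) x - (T ^^ n) y) > \<delta>" if \<epsilon>: "\<epsilon> > 0" for x0 \<epsilon>
  proof -
    obtain z n where n: "n \<ge> 1" and z: "weak_seminorm x' z < \<epsilon>"
      and big: "weak_seminorm x' ((T ^^ n) z) > \<delta>"
      using amp[OF \<epsilon>] by blast
    have "weak_seminorm x' ((T ^^ n) (x0 + z) - (T ^^ n) x0) > \<delta>"
      using big by (simp flip: funpow_diff[OF assms])
    moreover have "weak_seminorm x' ((x0 + z) - x0) < \<epsilon>"
      using z by simp
    moreover have "weak_seminorm x' (x0 - x0) < \<epsilon>"
      using \<epsilon> by (simp add: weak_seminorm_def)
    ultimately show ?thesis
      using n by blast
  qed
  then show "weakly_sensitive_weak_topology T"
    unfolding weakly_sensitive_weak_topology_def using \<open>\<delta> > 0\<close> \<open>x' \<noteq> 0\<close> by blast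
qed

lemma weak_seminorm_funpow_scaleR:
  "weak_seminorm x' (((*\<^sub>R) c ^^ n) x) = \<bar>c\<bar> ^ n * weak_seminorm x' x"
  by (induction n) (simp_all add: weak_seminorm_def abs_mult)

lemma weakly_sensitive_scaleR_iff:
  "weakly_sensitive_weak_topology ((*\<^sub>R) c) \<longleftrightarrow> \<bar>c\<bar> > 1"
proof
  assume "weakly_sensitive_weak_topology ((*\<^sub>R) c)"
  then obtain \<delta> x' z n where "weak_seminorm x' z < \<delta>"
    and "weak_seminorm x' (((*\<^sub>R) c ^^ n) z) > \<delta>"
    unfolding weakly_sensitive_linear_iff[OF linear_scaleR] by blast
  then have "1 * weak_seminorm x' z < \<bar>c\<bar> ^ n * weak_seminorm x' z"
    by (simp add: weak_seminorm_funpow_scaleR)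
  moreover have "weak_seminorm x' z \<ge> 0"
    by (simp add: weak_seminorm_def)
  ultimately have "\<bar>c\<bar> ^ n > 1"
    by (rule mult_right_less_imp_less)
  then show "\<bar>c\<bar> > 1"
    by (meson abs_ge_zero leI not_le power_le_one)
next
  assume c: "\<bar>c\<bar> > 1"
  define x' :: "real ^ 2" where "x' = axis 1 1"
  have "\<exists>z. \<exists>n\<ge>1. weak_seminorm x' z < \<epsilon> \<and> weak_seminorm x' (((*\<^sub>R) c ^^ n) z) > 1"
    if \<epsilon>: "\<epsilon> > 0" for \<epsilon>
  proof -
    let ?z = "(\<epsilon> / 2) *\<^sub>R x'"
    have z: "weak_seminorm x' ?z = \<epsilon> / 2"
      using \<epsilon> by (simp add: weak_seminorm_def x'_def inner_axis)
    obtain m where m: "2 / \<epsilon> < \<bar>c\<bar> ^ m"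
      using real_arch_pow[OF c] by blast
    \<comment> \<open>One further iterate costs nothing and makes the exponent positive.\<close>
    also have "\<bar>c\<bar> ^ m \<le> \<bar>c\<bar> ^ Suc m"
      using c by (intro power_increasing) auto
    finally have "\<bar>c\<bar> ^ Suc m * (\<epsilon> / 2) > 1"
      using \<epsilon> by (simp add: field_simps)
    then have "weak_seminorm x' (((*\<^sub>R) c ^^ Suc m) ?z) > 1"
      by (simp only: weak_seminorm_funpow_scaleR z)
    then show ?thesis
      using z \<epsilon> by (intro exI[of _ ?z] exI[of _ "Suc m"]) simp
  qed
  moreover have "x' \<noteq> 0"
    by (simp add: x'_def axis_eq_0_iff)
  ultimately show "weakly_sensitive_weak_topology ((*\<^sub>R) c)"
    unfolding weakly_sensitive_linear_iff[OF linear_scaleR]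
    by (intro exI[of _ 1]) auto
qed

text \<open>A single application of the map suffices: a vector in the kernel of \<open>x'\<close> is within
  every \<open>\<epsilon>\<close> of the origin, so the same \<open>z\<close> serves all of them.\<close>

lemma weakly_sensitive_if_kernel_not_invariant:
  assumes "linear T" and ker: "z \<bullet> x' = 0" and im: "T z \<bullet> x' \<noteq> 0"
  shows "weakly_sensitive_weak_topology T"
proof -
  let ?\<delta> = "\<bar>T z \<bullet> x'\<bar> / 2"
  have "\<exists>u. \<exists>n\<ge>1. weak_seminorm x' u < \<epsilon> \<and> weak_seminorm x' ((T ^^ n) u) > ?\<delta>"
    if "\<epsilon> > 0" for \<epsilon>
    using that ker im by (intro exI[of _ z] exI[of _ 1]) (simp add: weak_seminorm_def)
  moreover have "x' \<noteq> 0" "?\<delta> > 0"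
    using im by auto
  ultimately show ?thesis
    unfolding weakly_sensitive_linear_iff[OF \<open>linear T\<close>] by blast
qed

theorem theorem5p2:
  fixes l1 l2 :: real
    and A :: "real ^ 2 ^ 2"
    and T :: "real ^ 2 \<Rightarrow> real ^ 2"
  assumes A: "A = vector [vector [l1, 0], vector [0, l2]]"
    and T: "T = (\<lambda>x. A *v x)"
  shows "(l1 = l2 \<and> \<bar>l1\<bar> \<le> 1 \<longrightarrow> \<not> weakly_sensitive_weak_topology T) \<and>
         (\<not> (l1 = l2 \<and> \<bar>l1\<bar> \<le> 1) \<longrightarrow> weakly_sensitive_weak_topology T)"
proof (cases "l1 = l2")
  case True
  then have "T = (*\<^sub>R) l1"
    by (auto simp: T A fun_eq_iff vec_eq_iff forall_2 matrix_vector_mult_def sum_2)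
  then show ?thesis
    using True by (auto simp: weakly_sensitive_scaleR_iff)
next
  case False
  define z x' :: "real ^ 2" where "z = vector [1, -1]" and "x' = vector [1, 1]"
  have "linear T"
    by (simp add: T)
  moreover have "z \<bullet> x' = 0"
    by (simp add: z_def x'_def inner_vec_def sum_2)
  moreover have "T z \<bullet> x' = l1 - l2"
    by (simp add: T A z_def x'_def inner_vec_def sum_2 matrix_vector_mult_def)
  ultimately have "weakly_sensitive_weak_topology T"
    using False by (intro weakly_sensitive_if_kernel_not_invariant) auto
  then show ?thesis
    using False by simp
qed

end
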